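(* Consider an ODMTS design $\mathbf z^1$, and assume that the optimal route for trip $r$ under $\mathbf z^1$ is a direct shuttle trip from origin $or^r$ to destination $de^r$ with a trip time $t^1$. For any network $\mathbf z^2$ with $\mathbf z^1\ge\mathbf z^2$, the time $t^2$ of the optimal route for trip $r$ under $\mathbf z^2$ satisfies $t^2=t^1$.
   Context: $N$ is a finite set of nodes, $H\subseteq N$ the set of hubs. Trip $r$ has distinct origin $or^r$ and destination $de^r$ in $N\setminus H$. For $i,j\in N$, $t_{ij}\ge0$ and $d_{ij}\ge0$ are travel time and distance (possibly asymmetric), each satisfying the triangle inequality. $\theta\in[0,1]$, $g\ge0$ is the shuttle cost per mile, $s\ge0$ the average bus waiting time. Put $\gamma^r_{ij}=(1-\theta)g\,d_{ij}+\theta t_{ij}$ and $\tau^r_{hl}=\theta(t_{hl}+s)$. An ODMTS design (network) is a $\mathbf z\in\{0,1\}^{|H|\times|H|}$ ($z_{hl}=1$ iff the bus leg from $h$ to $l$ is open); $\mathbf z^1\ge\mathbf z^2$ means $z^1_{hl}\ge z^2_{hl}$ for all $h,l\in H$. Given $\mathbf z$, the optimal route of $r$ is a solution of: lexicographically minimize $\langle b^r,f^r\rangle$ (first $b^r$, then $f^r$) over binary $x^r_{hl}$ ($h,l\in H$) and $y^r_{ij}$ ($(i,j)\in A^r$), with $b^r=\sum\tau^r_{hl}x^r_{hl}+\sum\gamma^r_{ij}y^r_{ij}$, $f^r=\sum(t_{hl}+s)x^r_{hl}+\sum t_{ij}y^r_{ij}$, subject to $x^r_{hl}\le z_{hl}$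 and unit flow conservation from $or^r$ to $de^r$ over bus legs ($x$) and shuttle legs ($y$). Here $A^r=\{(or^r,h),(h,de^r):h\in H\}\cup\{(or^r,de^r)\}$ (other shuttle arcs are unnecessary by the triangle inequality). A route is either a direct shuttle ride from $or^r$ to $de^r$, or a shuttle from $or^r$ to a hub, bus leg(s) between hubs, and a shuttle from a hub to $de^r$. The (trip) time of the optimal route is the lexicographically optimal value of $f^r$ (unique for given $\mathbf z$). *)

theory Defs
  imports Complex_Main
begin

record 'n odmts =
  nodes :: "'n set"
  hubs :: "'n set"
  travel_time :: "'n \<Rightarrow> 'n \<Rightarrow> real"
  distance :: "'n \<Rightarrow> 'n \<Rightarrow> real"
  theta :: real
  shuttle_cost :: real
  bus_wait :: real

record 'n trip =
  origin :: 'n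
  dest :: 'n

definition triangle_on :: "'n set \<Rightarrow> ('n \<Rightarrow> 'n \<Rightarrow> real) \<Rightarrow> bool" where
  "triangle_on N m \<longleftrightarrow> (\<forall>i\<in>N. \<forall>j\<in>N. \<forall>k\<in>N. m i k \<le> m i j + m j k)"

definition valid_odmts :: "'n odmts \<Rightarrow> bool" where
  "valid_odmts S \<longleftrightarrow>
     finite (nodes S) \<and> hubs S \<subseteq> nodes S \<and>
     (\<forall>i\<in>nodes S. \<forall>j\<in>nodes S. 0 \<le> travel_time S i j \<and> 0 \<le> distance S i j) \<and>
     triangle_on (nodes S) (travel_time S) \<and> triangle_on (nodes S) (distance S) \<and>
     0 \<le> theta S \<and> theta S \<le> 1 \<and> 0 \<le> shuttle_cost S \<and> 0 \<le> bus_wait S"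

definition valid_trip :: "'n odmts \<Rightarrow> 'n trip \<Rightarrow> bool" where
  "valid_trip S r \<longleftrightarrow>
     origin r \<in> nodes S - hubs S \<and> dest r \<in> nodes S - hubs S \<and> origin r \<noteq> dest r"

definition shuttle_weight :: "'n odmts \<Rightarrow> 'n \<Rightarrow> 'n \<Rightarrow> real" where
  "shuttle_weight S i j =
     (1 - theta S) * shuttle_cost S * distance S i j + theta S * travel_time S i j"

definition bus_weight :: "'n odmts \<Rightarrow> 'n \<Rightarrow> 'n \<Rightarrow> real" where
  "bus_weight S h l = theta S * (travel_time S h l + bus_wait S)"

definition shuttle_arcs :: "'n odmts \<Rightarrow> 'n trip \<Rightarrow> ('n \<times> 'n) set" where
  "shuttle_arcs S r =
     (\<Union>h\<in>hubs S. {(origin r, h), (h, dest r)}) \<union> {(origin r, dest r)}"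

text \<open>
  Designs \<open>z\<close> and bus flows \<open>x\<close> are total functions of which only the values on
  \<open>hubs \<times> hubs\<close> matter; likewise only the values of a shuttle flow \<open>y\<close> on the
  shuttle arcs matter.
\<close>

definition design :: "'n odmts \<Rightarrow> ('n \<Rightarrow> 'n \<Rightarrow> real) \<Rightarrow> bool" where
  "design S z \<longleftrightarrow> (\<forall>h\<in>hubs S. \<forall>l\<in>hubs S. z h l \<in> {0, 1})"

definition design_le :: "'n odmts \<Rightarrow> ('n \<Rightarrow> 'n \<Rightarrow> real) \<Rightarrow> ('n \<Rightarrow> 'n \<Rightarrow> real) \<Rightarrow> bool" where
  "design_le S z z' \<longleftrightarrow> (\<forall>h\<in>hubs S. \<forall>l\<in>hubs S. z h l \<le> z' h l)"

definition net_outflow ::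
  "'n odmts \<Rightarrow> 'n trip \<Rightarrow> ('n \<Rightarrow> 'n \<Rightarrow> real) \<Rightarrow> ('n \<Rightarrow> 'n \<Rightarrow> real) \<Rightarrow> 'n \<Rightarrow> real" where
  "net_outflow S r x y i =
     (if i \<in> hubs S then \<Sum>h\<in>hubs S. x i h - x h i else 0)
     + (\<Sum>j | (i, j) \<in> shuttle_arcs S r. y i j)
     - (\<Sum>j | (j, i) \<in> shuttle_arcs S r. y j i)"

definition feasible_route ::
  "'n odmts \<Rightarrow> 'n trip \<Rightarrow> ('n \<Rightarrow> 'n \<Rightarrow> real) \<Rightarrow>
    ('n \<Rightarrow> 'n \<Rightarrow> real) \<Rightarrow> ('n \<Rightarrow> 'n \<Rightarrow> real) \<Rightarrow> bool" where
  "feasible_route S r z x y \<longleftrightarrow>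
     (\<forall>h\<in>hubs S. \<forall>l\<in>hubs S. x h l \<in> {0, 1} \<and> x h l \<le> z h l) \<and>
     (\<forall>(i, j)\<in>shuttle_arcs S r. y i j \<in> {0, 1}) \<and>
     (\<forall>i\<in>nodes S. net_outflow S r x y i =
        (if i = origin r then 1 else if i = dest r then - 1 else 0))"

definition route_cost ::
  "'n odmts \<Rightarrow> 'n trip \<Rightarrow> ('n \<Rightarrow> 'n \<Rightarrow> real) \<Rightarrow> ('n \<Rightarrow> 'n \<Rightarrow> real) \<Rightarrow> real" where
  "route_cost S r x y =
     (\<Sum>h\<in>hubs S. \<Sum>l\<in>hubs S. bus_weight S h l * x h l)
     + (\<Sum>(i, j)\<in>shuttle_arcs S r. shuttle_weight S i j * y i j)"

definition route_time ::
  "'n odmts \<Rightarrow> 'n trip \<Rightarrow> ('n \<Rightarrow> 'n \<Rightarrow> real) \<Rightarrow> ('n \<Rightarrow> 'n \<Rightarrow> real) \<Rightarrow> real" where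
  "route_time S r x y =
     (\<Sum>h\<in>hubs S. \<Sum>l\<in>hubs S. (travel_time S h l + bus_wait S) * x h l)
     + (\<Sum>(i, j)\<in>shuttle_arcs S r. travel_time S i j * y i j)"

definition lex_le :: "real \<times> real \<Rightarrow> real \<times> real \<Rightarrow> bool" where
  "lex_le p q \<longleftrightarrow> fst p < fst q \<or> (fst p = fst q \<and> snd p \<le> snd q)"

definition optimal_route ::
  "'n odmts \<Rightarrow> 'n trip \<Rightarrow> ('n \<Rightarrow> 'n \<Rightarrow> real) \<Rightarrow>
    ('n \<Rightarrow> 'n \<Rightarrow> real) \<Rightarrow> ('n \<Rightarrow> 'n \<Rightarrow> real) \<Rightarrow> bool" where
  "optimal_route S r z x y \<longleftrightarrow>
     feasible_route S r z x y \<and>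
     (\<forall>x' y'. feasible_route S r z x' y' \<longrightarrow>
        lex_le (route_cost S r x y, route_time S r x y)
               (route_cost S r x' y', route_time S r x' y'))"

definition optimal_time :: "'n odmts \<Rightarrow> 'n trip \<Rightarrow> ('n \<Rightarrow> 'n \<Rightarrow> real) \<Rightarrow> real" where
  "optimal_time S r z = (THE f. \<exists>x y. optimal_route S r z x y \<and> f = route_time S r x y)"

text \<open>
  If the direct arc carries the unit flow, conservation forces every other shuttle arc to be
  unused. The flow constraints do not exclude bus cycles disconnected from the direct ride; in an
  optimal solution such cycles contribute nothing to cost or time, and they are not excluded here.
\<close>

definition direct_shuttle :: "'n trip \<Rightarrow> ('n \<Rightarrow> 'n \<Rightarrow> real) \<Rightarrow> bool" where
  "direct_shuttle r y \<longleftrightarrow> y (origin r) (dest r) = 1"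

lemma finite_shuttle_arcs: "valid_odmts S \<Longrightarrow> finite (shuttle_arcs S r)"
  unfolding valid_odmts_def shuttle_arcs_def by (auto dest: finite_subset)

lemma direct_route_feasible:
  assumes S: "valid_odmts S" and r: "valid_trip S r" and z: "design S z"
  shows "feasible_route S r z (\<lambda>h l. 0) (\<lambda>i j. of_bool (i = origin r \<and> j = dest r))"
proof -
  let ?A = "shuttle_arcs S r" and ?o = "origin r" and ?d = "dest r"
  have fin: "finite ?A" by (rule finite_shuttle_arcs[OF S])
  have A: "(?o, ?d) \<in> ?A" by (simp add: shuttle_arcs_def)
  have od: "?o \<noteq> ?d" using r by (simp add: valid_trip_def)
  have fo: "finite {j. (i, j) \<in> ?A}" for i
    by (rule finite_subset[OF _ finite_imageI[OF fin, of snd]]) force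
  have fi: "finite {j. (j, i) \<in> ?A}" for i
    by (rule finite_subset[OF _ finite_imageI[OF fin, of fst]]) force
  have out: "(\<Sum>j | (i, j) \<in> ?A. of_bool (i = ?o \<and> j = ?d)) = (if i = ?o then 1 else (0::real))" for i
  proof (cases "i = ?o")
    case True
    have "(\<Sum>j | (?o, j) \<in> ?A. of_bool (j = ?d)) = (\<Sum>j | (?o, j) \<in> ?A. if j = ?d then 1 else (0::real))"
      by (rule sum.cong) auto
    also have "\<dots> = 1" using fo[of ?o] A by simp
    finally show ?thesis using True by simp
  qed simp
  have inn: "(\<Sum>j | (j, i) \<in> ?A. of_bool (j = ?o \<and> i = ?d)) = (if i = ?d then 1 else (0::real))" for i
  proof (cases "i = ?d")
    case True
    have "(\<Sum>j | (j, ?d) \<in> ?A. of_bool (j = ?o)) = (\<Sum>j | (j, ?d) \<in> ?A. if j = ?o then 1 else (0::real))"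
      by (rule sum.cong) auto
    also have "\<dots> = 1" using fi[of ?d] A by simp
    finally show ?thesis using True by simp
  qed simp
  have zero: "0 \<le> z h l" if "h \<in> hubs S" "l \<in> hubs S" for h l
    using z that by (force simp: design_def)
  show ?thesis
    unfolding feasible_route_def net_outflow_def out inn using od zero by auto
qed

lemma optimal_route_exists:
  assumes S: "valid_odmts S" and r: "valid_trip S r" and z: "design S z"
  shows "\<exists>x y. optimal_route S r z x y"
proof -
  let ?A = "shuttle_arcs S r" and ?H = "hubs S"
  have finA: "finite ?A" by (rule finite_shuttle_arcs[OF S])
  have finH: "finite ?H" using S by (auto simp: valid_odmts_def dest: finite_subset)
  define val where "val x y = (route_cost S r x y, route_time S r x y)" for x y
  define V where "V = {val x y | x y. feasible_route S r z x y}"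
  define x' :: "('a \<times> 'a) set \<Rightarrow> 'a \<Rightarrow> 'a \<Rightarrow> real" where "x' X i j = of_bool ((i, j) \<in> X)" for X i j
  have "V \<subseteq> (\<lambda>(X, Y). val (x' X) (x' Y)) ` (Pow (?H \<times> ?H) \<times> Pow ?A)"
  proof
    fix v assume "v \<in> V"
    then obtain x y where v: "v = val x y" and f: "feasible_route S r z x y"
      by (auto simp: V_def)
    define X where "X = {(h, l) \<in> ?H \<times> ?H. x h l = 1}"
    define Y where "Y = {(i, j) \<in> ?A. y i j = 1}"
    have xX: "x' X h l = x h l" if "h \<in> ?H" "l \<in> ?H" for h l
      using f that by (auto simp: feasible_route_def X_def x'_def)
    have yY: "x' Y i j = y i j" if "(i, j) \<in> ?A" for i j
      using f that by (auto simp: feasible_route_def Y_def x'_def)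
    have ys: "(\<Sum>(i, j)\<in>?A. w i j * y i j) = (\<Sum>(i, j)\<in>?A. w i j * x' Y i j)" for w
      by (rule sum.cong) (auto simp: yY)
    have "v = val (x' X) (x' Y)"
      unfolding v val_def route_cost_def route_time_def ys by (simp add: xX)
    moreover have "(X, Y) \<in> Pow (?H \<times> ?H) \<times> Pow ?A" by (auto simp: X_def Y_def)
    ultimately show "v \<in> (\<lambda>(X, Y). val (x' X) (x' Y)) ` (Pow (?H \<times> ?H) \<times> Pow ?A)"
      by force
  qed
  then have finV: "finite V" using finA finH by (auto intro: finite_subset)
  have neV: "V \<noteq> {}" using direct_route_feasible[OF S r z] unfolding V_def by blast
  define b where "b = Min (fst ` V)"
  have b: "b \<in> fst ` V" "\<And>v. v \<in> V \<Longrightarrow> b \<le> fst v"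
    using finV neV by (auto simp: b_def)
  define W where "W = {v \<in> V. fst v = b}"
  have W: "finite W" "W \<noteq> {}" using finV b(1) by (auto simp: W_def)
  define c where "c = Min (snd ` W)"
  have "c \<in> snd ` W" and c: "\<And>v. v \<in> W \<Longrightarrow> c \<le> snd v"
    using W by (auto simp: c_def)
  then have "(b, c) \<in> V" by (auto simp: W_def)
  then obtain x y where xy: "feasible_route S r z x y" "(b, c) = val x y"
    by (auto simp: V_def)
  have "lex_le (val x y) (val u w)" if "feasible_route S r z u w" for u w
  proof -
    have v: "val u w \<in> V" using that by (auto simp: V_def)
    show ?thesis
      using b(2)[OF v] c[of "val u w"] v unfolding xy(2)[symmetric] lex_le_def
      by (auto simp: W_def)
  qed
  then show ?thesis using xy(1) by (auto simp: optimal_route_def val_def)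
qed

lemma optimal_time_eqI: "optimal_time S r z = route_time S r x y" if "optimal_route S r z x y"
  unfolding optimal_time_def
proof (rule the_equality)
  show "\<exists>x' y'. optimal_route S r z x' y' \<and> route_time S r x y = route_time S r x' y'"
    using that by blast
next
  fix f assume "\<exists>x' y'. optimal_route S r z x' y' \<and> f = route_time S r x' y'"
  then obtain x' y' where o: "optimal_route S r z x' y'" and f: "f = route_time S r x' y'" by blast
  have "lex_le (route_cost S r x y, route_time S r x y) (route_cost S r x' y', route_time S r x' y')"
    and "lex_le (route_cost S r x' y', route_time S r x' y') (route_cost S r x y, route_time S r x y)"
    using o that by (auto simp: optimal_route_def)
  then show "f = route_time S r x y" by (auto simp: lex_le_def f)
qed

end

theory Submission
  imports Defs
begin

text \<open>
  All legs have nonnegative cost and time, so whatever bus cycles accompany a direct ride, the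
  ride alone costs no more and takes no longer; hence the bare ride is itself optimal under
  \<open>z1\<close>. It uses no bus leg, so it stays feasible when legs are closed, while closing legs only
  shrinks the feasible set: it remains optimal under \<open>z2\<close>.
\<close>

text \<open>Times and distances are known to be nonnegative only on \<open>nodes S\<close>, so sign
  arguments about shuttle legs go through this inclusion.\<close>

lemma shuttle_arcs_subset_nodes:
  assumes "valid_odmts S" "valid_trip S r"
  shows "shuttle_arcs S r \<subseteq> nodes S \<times> nodes S"
  using assms by (auto simp: shuttle_arcs_def valid_odmts_def valid_trip_def)

text \<open>Both objectives are linear in the flows with nonnegative coefficients on the relevant
  arcs. Hence routes can be compared arc by arc.\<close>

lemma
  assumes S: "valid_odmts S" and r: "valid_trip S r"
    and x: "\<And>h l. h \<in> hubs S \<Longrightarrow> l \<in> hubs S \<Longrightarrow> x h l \<le> x' h l"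
    and y: "\<And>i j. (i, j) \<in> shuttle_arcs S r \<Longrightarrow> y i j \<le> y' i j"
  shows route_cost_mono: "route_cost S r x y \<le> route_cost S r x' y'"
    and route_time_mono: "route_time S r x y \<le> route_time S r x' y'"
proof -
  have hubs: "h \<in> nodes S" if "h \<in> hubs S" for h
    using S that by (auto simp: valid_odmts_def)
  have arcs: "i \<in> nodes S" "j \<in> nodes S" if "(i, j) \<in> shuttle_arcs S r" for i j
    using shuttle_arcs_subset_nodes[OF S r] that by auto
  have time: "0 \<le> travel_time S i j" if "i \<in> nodes S" "j \<in> nodes S" for i j
    using S that by (simp add: valid_odmts_def)
  have bus: "0 \<le> bus_weight S i j" and shuttle: "0 \<le> shuttle_weight S i j"
    if "i \<in> nodes S" "j \<in> nodes S" for i j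
    using S that by (simp_all add: valid_odmts_def bus_weight_def shuttle_weight_def)
  have wait: "0 \<le> bus_wait S"
    using S by (simp add: valid_odmts_def)
  show "route_cost S r x y \<le> route_cost S r x' y'"
    unfolding route_cost_def
    by (intro add_mono sum_mono)
      (auto intro!: mult_left_mono x y bus shuttle dest: hubs arcs)
  show "route_time S r x y \<le> route_time S r x' y'"
    unfolding route_time_def
    by (intro add_mono sum_mono)
      (auto intro!: mult_left_mono x y add_nonneg_nonneg time wait dest: hubs arcs)
qed

lemma feasible_route_design_mono:
  assumes "design_le S z z'" "feasible_route S r z x y"
  shows "feasible_route S r z' x y"
  using assms unfolding feasible_route_def design_le_def by (blast intro: order_trans)

lemma lex_le_trans: "lex_le p q \<Longrightarrow> lex_le q s \<Longrightarrow> lex_le p s"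
  by (auto simp: lex_le_def)

text \<open>Every competitor under \<open>z\<close> already competes under the larger
  \<open>z'\<close>, so only feasibility of the route itself can be lost.\<close>

lemma optimal_route_design_antimono:
  assumes "design_le S z z'" "optimal_route S r z' x y" "feasible_route S r z x y"
  shows "optimal_route S r z x y"
  using assms by (auto simp: optimal_route_def dest: feasible_route_design_mono)

lemma optimal_direct_ride:
  assumes S: "valid_odmts S" and r: "valid_trip S r" and z: "design S z"
    and opt: "optimal_route S r z x y" and direct: "direct_shuttle r y"
  shows "optimal_route S r z (\<lambda>h l. 0) (\<lambda>i j. of_bool (i = origin r \<and> j = dest r))"
proof -
  let ?y = "\<lambda>i j. of_bool (i = origin r \<and> j = dest r) :: real"
  have feas: "feasible_route S r z x y"
    using opt by (simp add: optimal_route_def)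
  have x_nonneg: "0 \<le> x h l" if "h \<in> hubs S" "l \<in> hubs S" for h l
  proof -
    have "x h l \<in> {0, 1}" using feas that by (auto simp: feasible_route_def)
    then show ?thesis by auto
  qed
  \<comment> \<open>On the direct arc both sides are 1; on any other arc the left side is 0 and
    \<open>y\<close> is binary.\<close>
  have y_ge: "?y i j \<le> y i j" if "(i, j) \<in> shuttle_arcs S r" for i j
  proof -
    have "y i j \<in> {0, 1}" using feas that by (auto simp: feasible_route_def)
    then show ?thesis using direct by (auto simp: direct_shuttle_def)
  qed
  have "route_cost S r (\<lambda>h l. 0) ?y \<le> route_cost S r x y"
    by (rule route_cost_mono[OF S r]) (fact x_nonneg y_ge)+
  moreover have "route_time S r (\<lambda>h l. 0) ?y \<le> route_time S r x y"
    by (rule route_time_mono[OF S r]) (fact x_nonneg y_ge)+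
  ultimately have "lex_le (route_cost S r (\<lambda>h l. 0) ?y, route_time S r (\<lambda>h l. 0) ?y)
          (route_cost S r x y, route_time S r x y)"
    by (auto simp: lex_le_def)
  then show ?thesis
    using opt direct_route_feasible[OF S r z] lex_le_trans
    unfolding optimal_route_def by blast
qed

theorem proposition6:
  fixes S :: "'n odmts" and r :: "'n trip"
    and z1 z2 x1 y1 :: "'n \<Rightarrow> 'n \<Rightarrow> real" and t1 t2 :: real
  assumes "valid_odmts S" and "valid_trip S r"
    and "design S z1"
    and "optimal_route S r z1 x1 y1" and "direct_shuttle r y1"
    and "t1 = route_time S r x1 y1"
    and "design S z2" and "design_le S z2 z1"
    and "t2 = optimal_time S r z2"
  shows "t2 = t1"
proof -
  let ?y = "\<lambda>i j. of_bool (i = origin r \<and> j = dest r) :: real"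
  have opt1: "optimal_route S r z1 (\<lambda>h l. 0) ?y"
    using assms by (blast intro: optimal_direct_ride)
  have opt2: "optimal_route S r z2 (\<lambda>h l. 0) ?y"
    using assms opt1 by (blast intro: optimal_route_design_antimono direct_route_feasible)
  have "t2 = route_time S r (\<lambda>h l. 0) ?y"
    using assms optimal_time_eqI[OF opt2] by simp
  \<comment> \<open>\<open>x1\<close>, \<open>y1\<close> may differ from the bare ride, for instance
    by bus cycles of zero cost and time. Both are optimal under \<open>z1\<close>, so uniqueness of
    the lexicographic value equates their times.\<close>
  also have "\<dots> = optimal_time S r z1"
    using optimal_time_eqI[OF opt1] by simp
  also have "\<dots> = t1"
    using assms optimal_time_eqI by blast
  finally show ?thesis .
qed

end
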